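(* Property (iv) does not imply (weak) locally finite Hausdorff measure in the approximating dimension: there is a set $A\subset\mathbb{R}^2$ that has property (iv) for $j=1$ but does not have weak locally finite $\mathcal{H}^1$ measure.
   Context: $\mathcal{H}^j$ is $j$-dimensional Hausdorff measure and $B_\rho(y)$ the open ball. For an affine subspace $L\subset\mathbb{R}^n$ and $s>0$, $L^{s}:=\{x\in\mathbb{R}^n:|x-z|<s\text{ for some }z\in L\}$. Property (iv) (the fine weak $j$-dimensional approximation property with local $\rho_y$-uniformity) for a set $A\subset\mathbb{R}^n$: for every $\delta>0$ and every $y\in A$ there is $\rho_y>0$ such that for all $\rho\in(0,\rho_y]$ and all $x\in B_{\rho_y}(y)$ there is a $j$-dimensional affine space $L_{x,\rho}$ with $B_\rho(x)\cap A\subset L_{x,\rho}^{\delta\rho}$. A set $A\subset\mathbb{R}^n$ has weak locally finite $\mathcal{H}^j$ measure if for each $y\in A$ there is a radius $\rho_y>0$ with $\mathcal{H}^j(B_{\rho_y}(y)\cap A)<\infty$. *)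

theory Defs
  imports "HOL-Analysis.Analysis"
begin

text \<open>
  Hausdorff measure, normalised with the volume of the \<open>j\<close>-dimensional unit ball and regarded
  as an outer measure on all sets. Covering sets are required to be bounded because
  \<^const>\<open>diameter\<close> is \<open>0\<close> on unbounded sets; the empty set is treated separately because
  \<open>0 ^ 0 = 1\<close>.
\<close>

definition hausdorff_weight :: "nat \<Rightarrow> 'a::metric_space set \<Rightarrow> ennreal" where
  "hausdorff_weight j C =
     (if C = {} then 0 else ennreal (unit_ball_vol (real j) * (diameter C / 2) ^ j))"

definition hausdorff_premeasure :: "real \<Rightarrow> nat \<Rightarrow> 'a::metric_space set \<Rightarrow> ennreal" where
  "hausdorff_premeasure d j A =
     (INF C \<in> {C :: nat \<Rightarrow> 'a set.
                 A \<subseteq> (\<Union>i. C i) \<and> (\<forall>i. bounded (C i) \<and> diameter (C i) \<le> d)}.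
        \<Sum>i. hausdorff_weight j (C i))"

definition hausdorff_measure :: "nat \<Rightarrow> 'a::metric_space set \<Rightarrow> ennreal" where
  "hausdorff_measure j A = (SUP d \<in> {0<..}. hausdorff_premeasure d j A)"

definition thickening :: "'a::real_normed_vector set \<Rightarrow> real \<Rightarrow> 'a set" where
  "thickening L s = {x. \<exists>z\<in>L. norm (x - z) < s}"

definition fine_weak_approx_local_uniform :: "nat \<Rightarrow> 'a::euclidean_space set \<Rightarrow> bool" where
  "fine_weak_approx_local_uniform j A \<longleftrightarrow>
     (\<forall>\<delta>>0. \<forall>y\<in>A. \<exists>\<rho>\<^sub>y>0. \<forall>\<rho>\<in>{0<..\<rho>\<^sub>y}. \<forall>x\<in>ball y \<rho>\<^sub>y.
        \<exists>L. affine L \<and> aff_dim L = int j \<and> ball x \<rho> \<inter> A \<subseteq> thickening L (\<delta> * \<rho>))"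

definition weak_locally_finite_hausdorff :: "nat \<Rightarrow> 'a::metric_space set \<Rightarrow> bool" where
  "weak_locally_finite_hausdorff j A \<longleftrightarrow>
     (\<forall>y\<in>A. \<exists>\<rho>\<^sub>y>0. hausdorff_measure j (ball y \<rho>\<^sub>y \<inter> A) < \<infinity>)"

end

theory Submission
  imports Defs
begin

text \<open>
  The set is the graph of a lacunary series
  \<open>f x = (\<Sum>n. e n * a n * 2 ^ (- n) * cos (2 * pi * 2 ^ n * x))\<close> with signs \<open>e n\<close>, where \<open>a n\<close> tends
  to \<open>0\<close> but the sum of \<open>(a n)\<^sup>2\<close> diverges. At scale \<open>\<rho> \<approx> 2 ^ (- N)\<close> the terms with \<open>n < N\<close>
  are affine up to \<open>O(a N * \<rho>)\<close> and the remaining ones have size \<open>O(a N * \<rho>)\<close>, so \<open>f\<close> is uniformly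
  close to affine functions at all small scales. On the grid \<open>k / 2 ^ N\<close> the terms with
  \<open>n \<ge> N\<close> are constant. Passing to the next grid perturbs the slopes of the inscribed polygon by
  \<open>\<plusminus> 4 * a N\<close>, and by strict convexity of \<open>sqrt (1 + s\<^sup>2)\<close> one of the two choices of \<open>e N\<close> lengthens the
  polygon by a definite multiple of \<open>(a N)\<^sup>2\<close> as long as its length stays bounded; hence a greedy
  choice of signs makes the variation of \<open>f\<close> infinite. Variation is controlled by the
  one-dimensional Hausdorff measure of the graph, and local finiteness would globalise by compactness.
\<close>

section \<open>The lacunary series and its inscribed dyadic polygons\<close>

text \<open>The factor \<open>4\<close> normalises the slope perturbation \<open>4 * amp N\<close> to be at most \<open>1\<close>.\<close>

definition amp :: "nat \<Rightarrow> real" where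
  "amp n = 1 / (4 * sqrt (real n + 1))"

definition wave :: "nat \<Rightarrow> real \<Rightarrow> real" where
  "wave n x = amp n / 2 ^ n * cos (2 * pi * 2 ^ n * x)"

definition partial_wave :: "(nat \<Rightarrow> real) \<Rightarrow> nat \<Rightarrow> real \<Rightarrow> real" where
  "partial_wave e N x = (\<Sum>n<N. e n * wave n x)"

definition lacunary :: "(nat \<Rightarrow> real) \<Rightarrow> real \<Rightarrow> real" where
  "lacunary e x = (\<Sum>n. e n * wave n x)"

text \<open>Arc length per unit of horizontal length along a line of slope \<open>s\<close>.\<close>

definition bracket :: "real \<Rightarrow> real" where
  "bracket s = sqrt (1 + s\<^sup>2)"

definition dyadic_slope :: "nat \<Rightarrow> (real \<Rightarrow> real) \<Rightarrow> nat \<Rightarrow> real" where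
  "dyadic_slope N g k = 2 ^ N * (g (real (Suc k) / 2 ^ N) - g (real k / 2 ^ N))"

text \<open>The length of the polygon inscribed in the graph over the unit interval, with vertices
  above the points \<open>k / 2 ^ N\<close>.\<close>

definition polygon_length :: "nat \<Rightarrow> (real \<Rightarrow> real) \<Rightarrow> real" where
  "polygon_length N g = (\<Sum>k<2 ^ N. bracket (dyadic_slope N g k)) / 2 ^ N"

section \<open>Amplitude estimates and convergence of the series\<close>

lemma amp_pos: "amp n > 0"
  by (simp add: amp_def)

lemma amp_antimono: "m \<le> n \<Longrightarrow> amp n \<le> amp m"
  unfolding amp_def by (intro divide_left_mono mult_left_mono) auto

lemma amp_Suc_ge: "2 * amp n \<le> 3 * amp (Suc n)"
proof -
  have "2 * sqrt (real n + 2) \<le> 3 * sqrt (real n + 1)"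
    by (rule power2_le_imp_le) (simp_all add: power_mult_distrib)
  then show ?thesis unfolding amp_def
    by (simp add: field_simps)
qed

lemma amp_tendsto_0: "amp \<longlonglongrightarrow> 0"
  unfolding amp_def by real_asymp

text \<open>By \<open>amp_Suc_ge\<close> the terms grow at least by the ratio 4/3, so the sum is
  comparable to its last term. Up to a constant these terms bound the second derivatives of the
  waves.\<close>

lemma sum_amp_pow2_le: "(\<Sum>n<N. amp n * 2 ^ n) \<le> 3 * amp N * 2 ^ N"
proof (induction N)
  case 0
  show ?case using amp_pos[of 0] by simp
next
  case (Suc N)
  have "(\<Sum>n<Suc N. amp n * 2 ^ n) \<le> (2 * amp N) * (2 * 2 ^ N)" using Suc by simp
  also have "\<dots> \<le> (3 * amp (Suc N)) * (2 * 2 ^ N)"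
    by (intro mult_right_mono amp_Suc_ge) auto
  finally show ?case by simp
qed

lemma wave_abs_le: "\<bar>wave n x\<bar> \<le> amp n / 2 ^ n"
  unfolding wave_def abs_mult using amp_pos[of n]
  by (intro mult_left_le[THEN order_trans]) (auto simp: abs_cos_le_one)

lemma wave_abs_le': "\<bar>wave n x\<bar> \<le> (1/2) ^ n"
proof -
  have "amp n \<le> 1" using amp_antimono[of 0 n] amp_def[of 0] by simp
  then have "amp n / 2 ^ n \<le> (1/2) ^ n" by (simp add: power_divide divide_right_mono)
  with wave_abs_le[of n x] show ?thesis by linarith
qed

lemma signed_wave_abs_le:
  assumes "\<And>n. \<bar>e n\<bar> \<le> 1"
  shows "\<bar>e n * wave n x\<bar> \<le> (1/2) ^ n"
  using mult_mono[OF assms[of n] wave_abs_le'[of n x]] by (simp add: abs_mult)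

lemma summable_wave:
  assumes "\<And>n. \<bar>e n\<bar> \<le> 1"
  shows "summable (\<lambda>n. e n * wave n x)"
  by (rule summable_comparison_test'[of "\<lambda>n. (1/2)^n" 0])
    (use signed_wave_abs_le[OF assms] in auto)

lemma continuous_lacunary:
  assumes "\<And>n. \<bar>e n\<bar> \<le> 1"
  shows "continuous_on UNIV (lacunary e)"
proof -
  have "uniform_limit UNIV (\<lambda>N x. \<Sum>n<N. e n * wave n x) (\<lambda>x. \<Sum>n. e n * wave n x) sequentially"
    by (rule Weierstrass_m_test[of _ _ "\<lambda>n. (1/2)^n"])
      (use signed_wave_abs_le[OF assms] in auto)
  then show ?thesis unfolding lacunary_def[abs_def]
    by (rule uniform_limit_theorem[rotated])
      (auto simp: wave_def intro!: always_eventually continuous_intros)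
qed

text \<open>Supplies the constant \<open>c\<close> in
  \<open>locally_finite_graph_imp_bounded_variation\<close>.\<close>

lemma lacunary_bounded:
  assumes "\<And>n. \<bar>e n\<bar> \<le> 1"
  shows "\<bar>lacunary e x\<bar> \<le> 2"
proof -
  have b: "\<bar>e n * wave n x\<bar> \<le> (1/2) ^ n" for n by (rule signed_wave_abs_le[OF assms])
  have g: "summable (\<lambda>n. (1/2 :: real) ^ n)" by simp
  have a: "summable (\<lambda>n. \<bar>e n * wave n x\<bar>)"
    by (rule summable_comparison_test'[OF g, of 0]) (use b in auto)
  have "\<bar>lacunary e x\<bar> \<le> (\<Sum>n. \<bar>e n * wave n x\<bar>)"
    unfolding lacunary_def by (rule summable_rabs[OF a])
  also have "\<dots> \<le> (\<Sum>n. (1/2) ^ n)" by (rule suminf_le[OF b a g])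
  finally show ?thesis by (simp add: suminf_geometric)
qed

lemma lacunary_split:
  assumes "\<And>n. \<bar>e n\<bar> \<le> 1"
  shows "lacunary e x = partial_wave e N x + (\<Sum>n. e (n + N) * wave (n + N) x)"
  unfolding lacunary_def partial_wave_def
  using suminf_split_initial_segment[OF summable_wave[of e x, OF assms], of N] by simp

section \<open>Values and chord slopes on the dyadic grid\<close>

lemma wave_dyadic:
  assumes "N \<le> n"
  shows "wave n (real k / 2 ^ N) = amp n / 2 ^ n"
proof -
  obtain m where m: "n = N + m" using assms le_Suc_ex by blast
  have "2 * pi * 2 ^ n * (real k / 2 ^ N) = 2 * pi * of_int (int (2 ^ m * k))"
    by (simp add: m power_add)
  then show ?thesis unfolding wave_def by (simp only: cos_int_2pin)
qed

text \<open>On the grid of level \<open>N\<close> the tail of the series takes one and the same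
  value at every point, so it cancels in differences.\<close>

lemma dyadic_slope_lacunary:
  assumes "\<And>n. \<bar>e n\<bar> \<le> 1"
  shows "dyadic_slope N (lacunary e) k = dyadic_slope N (partial_wave e N) k"
proof -
  have "lacunary e (real j / 2 ^ N) = partial_wave e N (real j / 2 ^ N)
      + (\<Sum>n. e (n + N) * (amp (n + N) / 2 ^ (n + N)))" for j
    unfolding lacunary_split[of e, OF assms, where N = N] using wave_dyadic[of N] by simp
  from this[of k] this[of "Suc k"] show ?thesis
    unfolding dyadic_slope_def by simp
qed

section \<open>Uniform flatness at small scales\<close>

lemma cos_Taylor1: "\<bar>cos (u + h) - cos u + h * sin u\<bar> \<le> h\<^sup>2" for u h :: real
proof -
  have s: "\<bar>sin h - h\<bar> \<le> h\<^sup>2 / 2"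
    using Maclaurin_sin_bound[of h 2] by (simp add: sin_coeff_def numeral_2_eq_2)
  \<comment> \<open>The half-angle identity writes \<open>1 - cos h\<close> as twice the square of
    \<open>sin (h/2)\<close>.\<close>
  have "\<bar>sin (h/2)\<bar> \<le> \<bar>h/2\<bar>" by (rule abs_sin_x_le_abs_x)
  then have "(sin (h/2))\<^sup>2 \<le> (h/2)\<^sup>2" by (simp only: abs_le_square_iff)
  then have c: "\<bar>cos h - 1\<bar> \<le> h\<^sup>2 / 2"
    using cos_double_sin[of "h/2"] by (simp add: power_divide)
  have "cos (u + h) - cos u + h * sin u = cos u * (cos h - 1) - sin u * (sin h - h)"
    by (simp add: cos_add algebra_simps)
  also have "\<bar>\<dots>\<bar> \<le> \<bar>cos u\<bar> * \<bar>cos h - 1\<bar> + \<bar>sin u\<bar> * \<bar>sin h - h\<bar>"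
    using abs_triangle_ineq4 by (simp only: abs_mult[symmetric])
  also have "\<dots> \<le> 1 * (h\<^sup>2 / 2) + 1 * (h\<^sup>2 / 2)"
    by (intro add_mono mult_mono s c) (auto simp: abs_cos_le_one abs_sin_le_one)
  finally show ?thesis by simp
qed

lemma wave_Taylor1:
  "\<bar>wave n x - wave n c + 2 * pi * amp n * sin (2 * pi * 2 ^ n * c) * (x - c)\<bar>
     \<le> 4 * pi\<^sup>2 * (amp n * 2 ^ n) * (x - c)\<^sup>2"
proof -
  define w :: real where "w = 2 * pi * 2 ^ n"
  have "wave n x - wave n c + 2 * pi * amp n * sin (2 * pi * 2 ^ n * c) * (x - c)
      = amp n / 2 ^ n * (cos (w * c + w * (x - c)) - cos (w * c) + w * (x - c) * sin (w * c))"
    by (simp add: wave_def w_def field_simps)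
  also have "\<bar>\<dots>\<bar> \<le> amp n / 2 ^ n * (w * (x - c))\<^sup>2"
    unfolding abs_mult using amp_pos[of n] cos_Taylor1[of "w * c" "w * (x - c)"]
    by (intro mult_mono) auto
  also have "\<dots> = 4 * pi\<^sup>2 * (amp n * 2 ^ n) * (x - c)\<^sup>2"
    by (simp add: w_def power2_eq_square field_simps)
  finally show ?thesis .
qed

text \<open>The slope is the derivative at \<open>c\<close> of the first \<open>N\<close> terms. It
  may grow with \<open>N\<close>, as the amplitudes are not summable; only the error must be small.
  The term 12 pi^2 comes from the Taylor errors of these waves, the term 8 from the tail.\<close>

lemma lacunary_flat_at_scale:
  assumes e: "\<And>n. \<bar>e n\<bar> \<le> 1"
    and N: "1 / 2 ^ Suc N < \<rho>" "\<rho> \<le> 1 / 2 ^ N" and x: "\<bar>x - c\<bar> \<le> \<rho>"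
  shows "\<bar>lacunary e x - lacunary e c
      - (\<Sum>n<N. - (e n * (2 * pi * amp n * sin (2 * pi * 2 ^ n * c)))) * (x - c)\<bar>
    \<le> (12 * pi\<^sup>2 + 8) * amp N * \<rho>"
proof -
  let ?D = "\<lambda>n. 2 * pi * amp n * sin (2 * pi * 2 ^ n * c)"
  let ?t = "\<lambda>n. e (n + N) * wave (n + N) x - e (n + N) * wave (n + N) c"
  have \<rho>: "\<rho> > 0" using N(1) by (rule less_trans[rotated]) simp
  have sx: "summable (\<lambda>n. e (n + N) * wave (n + N) z)" for z
    using summable_wave[of "\<lambda>n. e n" z, OF e] by (rule summable_ignore_initial_segment)
  have tb: "\<bar>?t n\<bar> \<le> 2 * amp N / 2 ^ N * (1/2) ^ n" for n
  proof -
    have b: "\<bar>e (n + N) * wave (n + N) z\<bar> \<le> amp N / 2 ^ N * (1/2) ^ n" for z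
    proof -
      have "\<bar>e (n + N) * wave (n + N) z\<bar> \<le> 1 * (amp (n + N) / 2 ^ (n + N))"
        unfolding abs_mult by (intro mult_mono e wave_abs_le) auto
      also have "\<dots> \<le> amp N / 2 ^ (n + N)"
        using amp_antimono[of N "n + N"] by (simp add: divide_right_mono)
      finally show ?thesis by (simp add: power_add power_divide field_simps)
    qed
    show ?thesis using b[of x] b[of c] by (simp add: abs_le_iff)
  qed
  have gs: "(\<lambda>n. 2 * amp N / 2 ^ N * (1/2) ^ n) sums (2 * amp N / 2 ^ N * 2)"
    using geometric_sums[of "1/2 :: real"] by (intro sums_mult) simp
  have ts: "summable (\<lambda>n. \<bar>?t n\<bar>)"
    by (rule summable_comparison_test'[OF sums_summable[OF gs], of 0]) (use tb in auto)
  have "\<bar>\<Sum>n. ?t n\<bar> \<le> (\<Sum>n. \<bar>?t n\<bar>)" using ts by (rule summable_rabs)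
  also have "\<dots> \<le> 2 * amp N / 2 ^ N * 2"
    using suminf_le[OF tb ts sums_summable[OF gs]] sums_unique[OF gs] by simp
  \<comment> \<open>Passing to the next power of two brings in the lower bound on
    \<open>\<rho>\<close>.\<close>
  also have "\<dots> = 8 * amp N * (1 / 2 ^ Suc N)" by simp
  also have "\<dots> \<le> 8 * amp N * \<rho>" using N amp_pos[of N] by (intro mult_left_mono) auto
  finally have tail: "\<bar>\<Sum>n. ?t n\<bar> \<le> 8 * amp N * \<rho>" .
  \<comment> \<open>One factor is bounded by \<open>\<rho>\<close> and the other by
    \<open>1 / 2 ^ N\<close>, which later cancels the power in
    \<open>sum_amp_pow2_le\<close>.\<close>
  have x2: "(x - c)\<^sup>2 \<le> \<rho> * (1 / 2 ^ N)"
  proof -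
    have "(x - c)\<^sup>2 = \<bar>x - c\<bar> * \<bar>x - c\<bar>" by (simp add: power2_eq_square)
    also have "\<dots> \<le> \<rho> * (1 / 2 ^ N)" using x N \<rho> by (intro mult_mono) auto
    finally show ?thesis .
  qed
  have "\<bar>\<Sum>n<N. e n * (wave n x - wave n c + ?D n * (x - c))\<bar>
      \<le> (\<Sum>n<N. 1 * (4 * pi\<^sup>2 * (amp n * 2 ^ n) * (x - c)\<^sup>2))"
  proof (rule order_trans[OF sum_abs sum_mono])
    show "\<bar>e n * (wave n x - wave n c + ?D n * (x - c))\<bar>
        \<le> 1 * (4 * pi\<^sup>2 * (amp n * 2 ^ n) * (x - c)\<^sup>2)" for n
      unfolding abs_mult[of "e n"] by (intro mult_mono e wave_Taylor1) auto
  qed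
  also have "\<dots> = 4 * pi\<^sup>2 * (x - c)\<^sup>2 * (\<Sum>n<N. amp n * 2 ^ n)"
    by (simp add: sum_distrib_left mult_ac)
  also have "\<dots> \<le> 4 * pi\<^sup>2 * (\<rho> * (1 / 2 ^ N)) * (3 * amp N * 2 ^ N)"
    using \<rho> amp_pos
    by (intro mult_mono sum_amp_pow2_le x2 sum_nonneg) (auto intro: less_imp_le)
  also have "\<dots> = 12 * pi\<^sup>2 * amp N * \<rho>" by simp
  finally have head: "\<bar>\<Sum>n<N. e n * (wave n x - wave n c + ?D n * (x - c))\<bar>
      \<le> 12 * pi\<^sup>2 * amp N * \<rho>" .
  have "lacunary e x - lacunary e c - (\<Sum>n<N. - (e n * ?D n)) * (x - c)
      = (\<Sum>n<N. e n * (wave n x - wave n c + ?D n * (x - c))) + (\<Sum>n. ?t n)"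
    unfolding lacunary_split[OF e, where N = N] suminf_diff[OF sx sx, symmetric] partial_wave_def
    by (simp add: algebra_simps sum_distrib_left sum_distrib_right sum.distrib sum_subtractf
        sum_negf)
  with head tail show ?thesis by (simp add: algebra_simps)
qed

lemma ex_dyadic_scale:
  assumes "0 < \<rho>" "\<rho> \<le> (1::real) / 2 ^ N0"
  obtains N where "N0 \<le> N" "1 / 2 ^ Suc N < \<rho>" "\<rho> \<le> 1 / 2 ^ N"
proof -
  obtain m where m: "(1/2 :: real) ^ m < \<rho>" using real_arch_pow_inv[of \<rho> "1/2"] assms by auto
  \<comment> \<open>The scale sought is \<open>M - 1\<close>. That \<open>N0 < M\<close> keeps the
    subtraction from truncating and gives \<open>N0 \<le> M - 1\<close>.\<close>
  define M where "M = (LEAST m. 1 / 2 ^ m < \<rho>)"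
  have M: "1 / 2 ^ M < \<rho>" unfolding M_def
    by (rule LeastI[of _ m]) (use m in \<open>simp add: power_divide\<close>)
  have "N0 < M"
  proof (rule ccontr)
    assume "\<not> N0 < M"
    then have "(1::real) / 2 ^ N0 \<le> 1 / 2 ^ M" by (simp add: frac_le)
    with M assms show False by simp
  qed
  moreover have "\<not> 1 / 2 ^ (M - 1) < \<rho>"
    using \<open>N0 < M\<close> not_less_Least[of "M - 1" "\<lambda>m. 1 / 2 ^ m < \<rho>"] by (simp add: M_def)
  ultimately show thesis using M that[of "M - 1"] by auto
qed

lemma lacunary_flat:
  assumes e: "\<And>n. \<bar>e n\<bar> \<le> 1" and "\<delta> > 0"
  shows "\<exists>r>0. \<forall>\<rho> c. 0 < \<rho> \<longrightarrow> \<rho> \<le> r \<longrightarrow>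
      (\<exists>m. \<forall>x. \<bar>x - c\<bar> \<le> \<rho> \<longrightarrow> \<bar>lacunary e x - lacunary e c - m * (x - c)\<bar> < \<delta> * \<rho>)"
proof -
  have "(\<lambda>n. (12 * pi\<^sup>2 + 8) * amp n) \<longlonglongrightarrow> (12 * pi\<^sup>2 + 8) * 0"
    by (intro tendsto_intros amp_tendsto_0)
  then have "\<forall>\<^sub>F n in sequentially. (12 * pi\<^sup>2 + 8) * amp n < \<delta>"
    using \<open>\<delta> > 0\<close> by (intro order_tendstoD) auto
  then obtain N0 where N0: "\<And>n. n \<ge> N0 \<Longrightarrow> (12 * pi\<^sup>2 + 8) * amp n < \<delta>"
    by (auto simp: eventually_sequentially)
  show ?thesis
  proof (rule exI[of _ "1 / 2 ^ N0"], intro conjI allI impI)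
    fix \<rho> c :: real assume "0 < \<rho>" "\<rho> \<le> 1 / 2 ^ N0"
    then obtain N where N: "N0 \<le> N" "1 / 2 ^ Suc N < \<rho>" "\<rho> \<le> 1 / 2 ^ N"
      by (rule ex_dyadic_scale)
    have "(12 * pi\<^sup>2 + 8) * amp N * \<rho> < \<delta> * \<rho>"
      using N0[OF N(1)] \<open>0 < \<rho>\<close> by (intro mult_strict_right_mono)
    then show "\<exists>m. \<forall>x. \<bar>x - c\<bar> \<le> \<rho> \<longrightarrow>
        \<bar>lacunary e x - lacunary e c - m * (x - c)\<bar> < \<delta> * \<rho>"
      using lacunary_flat_at_scale[of e, OF e N(2,3)] by (meson le_less_trans)
  qed simp
qed

section \<open>Quantitative convexity of arc length in the slope\<close>

lemma bracket_ge_1: "bracket s \<ge> 1"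
  by (simp add: bracket_def)

lemma bracket_power2: "(bracket s)\<^sup>2 = 1 + s\<^sup>2"
  by (simp add: bracket_def)

lemma bracket_le: "bracket s \<le> 1 + \<bar>s\<bar>"
  unfolding bracket_def by (rule real_le_lsqrt) (auto simp: power2_eq_square algebra_simps)

text \<open>The triangle inequality for the vectors with first coordinate 1 and second coordinates
  \<open>s + d\<close> and \<open>s - d\<close>.\<close>

lemma bracket_midpoint_convex: "2 * bracket s \<le> bracket (s + d) + bracket (s - d)"
proof -
  have "norm (Complex 1 (s + d) + Complex 1 (s - d))
      \<le> norm (Complex 1 (s + d)) + norm (Complex 1 (s - d))" by (rule norm_triangle_ineq)
  moreover have "Complex 1 (s + d) + Complex 1 (s - d) = 2 * Complex 1 s"
    by (simp add: complex_eq_iff)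
  ultimately show ?thesis by (simp add: norm_mult bracket_def complex_norm)
qed

text \<open>The second derivative of \<open>bracket\<close> is \<open>1 / bracket s ^ 3\<close>, so
  the gain is \<open>d\<^sup>2 / bracket s ^ 3\<close> to leading order; the factor 1/4 leaves room
  for the remainder. With Q = 1 + s^2, both squared sides are compared with 4 Q + 2 d^2 / Q.\<close>

lemma bracket_midpoint_strict_convex:
  assumes "0 \<le> d" "d \<le> 1"
  shows "2 * bracket s + d\<^sup>2 / (4 * bracket s ^ 3) \<le> bracket (s + d) + bracket (s - d)"
proof (rule power2_le_imp_le)
  define Q where "Q = 1 + s\<^sup>2"
  have Q: "Q \<ge> 1" by (simp add: Q_def)
  have bQ: "(bracket s)\<^sup>2 = Q" by (simp add: bracket_power2 Q_def)
  have b1: "bracket s \<ge> 1" by (rule bracket_ge_1)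
  have d2: "d\<^sup>2 \<le> 1" using assms by (simp add: power_le_one)
  have "Q - d\<^sup>2 + d\<^sup>2 / Q \<le> sqrt ((Q - d\<^sup>2)\<^sup>2 + 4 * d\<^sup>2)"
  proof (rule real_le_rsqrt)
    have "(Q - d\<^sup>2) * (d\<^sup>2 / Q) \<le> Q * (d\<^sup>2 / Q)"
      using Q by (intro mult_right_mono) auto
    moreover have "(d\<^sup>2 / Q)\<^sup>2 \<le> d\<^sup>2"
    proof -
      have "d\<^sup>2 / Q \<le> d\<^sup>2" using Q by (simp add: divide_le_eq mult_le_cancel_left1)
      then have "(d\<^sup>2 / Q) * (d\<^sup>2 / Q) \<le> d\<^sup>2 * 1"
        using d2 Q by (intro mult_mono) auto
      then show ?thesis by (simp add: power2_eq_square)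
    qed
    moreover have "Q * (d\<^sup>2 / Q) = d\<^sup>2" using Q by simp
    moreover have "(Q - d\<^sup>2 + d\<^sup>2 / Q)\<^sup>2
        = (Q - d\<^sup>2)\<^sup>2 + (d\<^sup>2 / Q)\<^sup>2 + 2 * ((Q - d\<^sup>2) * (d\<^sup>2 / Q))"
      by (simp only: power2_sum mult.assoc)
    ultimately show "(Q - d\<^sup>2 + d\<^sup>2 / Q)\<^sup>2 \<le> (Q - d\<^sup>2)\<^sup>2 + 4 * d\<^sup>2"
      using zero_le_power2[of d] by linarith
  qed
  moreover have "bracket (s + d) * bracket (s - d) = sqrt ((Q - d\<^sup>2)\<^sup>2 + 4 * d\<^sup>2)"
    unfolding bracket_def real_sqrt_mult[symmetric] Q_def
    by (rule arg_cong[of _ _ sqrt]) (simp add: power2_eq_square algebra_simps)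
  moreover have "(bracket (s + d))\<^sup>2 + (bracket (s - d))\<^sup>2 = 2 * Q + 2 * d\<^sup>2"
    unfolding bracket_power2 Q_def by (simp add: power2_eq_square algebra_simps)
  ultimately have lower: "4 * Q + 2 * (d\<^sup>2 / Q) \<le> (bracket (s + d) + bracket (s - d))\<^sup>2"
    by (simp add: power2_sum)
  have "(2 * bracket s + d\<^sup>2 / (4 * bracket s ^ 3))\<^sup>2
      = 4 * Q + d\<^sup>2 / (bracket s)\<^sup>2 + (d\<^sup>2 / (4 * bracket s ^ 3))\<^sup>2"
    using b1 unfolding bQ[symmetric] by (simp add: power2_eq_square power3_eq_cube field_simps)
  also have "(d\<^sup>2 / (4 * bracket s ^ 3))\<^sup>2 \<le> d\<^sup>2 / (bracket s)\<^sup>2"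
  proof -
    have "d\<^sup>2 / (4 * bracket s ^ 3) \<le> 1"
      using d2 one_le_power[OF b1, of 3] by (subst divide_le_eq_1_pos) linarith+
    moreover have "d\<^sup>2 / (4 * bracket s ^ 3) \<le> d\<^sup>2 / (bracket s)\<^sup>2"
    proof (rule divide_left_mono)
      have "(bracket s)\<^sup>2 \<le> bracket s ^ 3" using b1 by (intro power_increasing) auto
      then show "(bracket s)\<^sup>2 \<le> 4 * bracket s ^ 3" using b1 by (smt (verit) zero_le_power)
    qed (use b1 in auto)
    ultimately have "(d\<^sup>2 / (4 * bracket s ^ 3)) * (d\<^sup>2 / (4 * bracket s ^ 3))
        \<le> d\<^sup>2 / (bracket s)\<^sup>2 * 1" using b1 by (intro mult_mono) auto
    then show ?thesis by (simp add: power2_eq_square)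
  qed
  finally show "(2 * bracket s + d\<^sup>2 / (4 * bracket s ^ 3))\<^sup>2
      \<le> (bracket (s + d) + bracket (s - d))\<^sup>2"
    using lower bQ by simp
qed (use bracket_ge_1[of "s + d"] bracket_ge_1[of "s - d"] in linarith)

text \<open>The left side is the tangent at \<open>V\<close> to the convex function
  \<open>1 / y ^ 3\<close>.\<close>

lemma inverse_cube_ge_tangent:
  assumes "y \<ge> (1::real)" "V \<ge> 1"
  shows "4 / V ^ 3 - 3 * y / V ^ 4 \<le> 1 / y ^ 3"
proof -
  have "4 * y ^ 3 * V \<le> 3 * y ^ 4 + V ^ 4"
  proof -
    \<comment> \<open>The double root at \<open>y = V\<close> reflects the tangency.\<close>
    have "3 * y ^ 4 + V ^ 4 - 4 * y ^ 3 * V = (y - V)\<^sup>2 * (2 * y\<^sup>2 + (y + V)\<^sup>2)"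
      by (simp add: power2_eq_square power3_eq_cube power4_eq_xxxx algebra_simps)
    moreover have "\<dots> \<ge> 0" by simp
    ultimately show ?thesis by linarith
  qed
  moreover have "0 < y ^ 3" "0 < V ^ 4" using assms by auto
  ultimately have "(4 * V - 3 * y) / V ^ 4 \<le> 1 / y ^ 3"
    by (simp add: divide_le_eq le_divide_eq)
      (simp add: field_simps power3_eq_cube power4_eq_xxxx)
  moreover have "4 / V ^ 3 = 4 * V / V ^ 4" using assms by (simp add: power_eq_if)
  ultimately show ?thesis by (simp add: diff_divide_distrib)
qed


section \<open>Greedy choice of signs and growth of the polygons\<close>

lemma dyadic_slope_eq_mean:
  "dyadic_slope N g k = (dyadic_slope (Suc N) g (2 * k) + dyadic_slope (Suc N) g (2 * k + 1)) / 2"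
proof -
  have "real (2 * k) / 2 ^ Suc N = real k / 2 ^ N"
    "real (Suc (Suc (2 * k))) / 2 ^ Suc N = real (Suc k) / 2 ^ N"
    by (simp_all add: field_simps)
  moreover have "2 ^ N * (q - p) = (2 ^ Suc N * (m - p) + 2 ^ Suc N * (q - m)) / 2" for p q m :: real
    by (simp add: algebra_simps)
  ultimately show ?thesis
    unfolding dyadic_slope_def Suc_eq_plus1[symmetric] by simp
qed

text \<open>On the grid of level \<open>Suc N\<close> the wave alternates between its extreme
  values, which differ by \<open>2 * amp N / 2 ^ N\<close>; dividing by the mesh gives
  \<open>4 * amp N\<close>.\<close>

lemma dyadic_slope_add_wave:
  "dyadic_slope (Suc N) (\<lambda>x. g x + c * wave N x) j
    = dyadic_slope (Suc N) g j - (-1) ^ j * (c * (4 * amp N))"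
proof -
  have "wave N (real i / 2 ^ Suc N) = amp N / 2 ^ N * (-1) ^ i" for i
  proof -
    have "2 * pi * 2 ^ N * (real i / 2 ^ Suc N) = real i * pi" by simp
    then show ?thesis unfolding wave_def by (simp only: cos_npi)
  qed
  from this[of j] this[of "Suc j"] show ?thesis
    unfolding dyadic_slope_def by (simp add: algebra_simps del: of_nat_Suc)
qed

text \<open>
  If \<open>D\<close> is half the difference of the two slopes over a refined grid interval, the perturbed
  slopes for the two signs are \<open>s + \<sigma> \<plusminus> D\<close> and \<open>s - \<sigma> \<plusminus> D\<close>; convexity removes the unknown \<open>D\<close>.
\<close>

lemma sum_polygon_length_refine:
  "2 * polygon_length N g
      + (4 * amp N)\<^sup>2 / 4 * ((\<Sum>k<2 ^ N. 1 / bracket (dyadic_slope N g k) ^ 3) / 2 ^ N)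
    \<le> polygon_length (Suc N) (\<lambda>x. g x + 1 * wave N x)
      + polygon_length (Suc N) (\<lambda>x. g x + (-1) * wave N x)"
proof -
  define \<sigma> where "\<sigma> = 4 * amp N"
  define gp where "gp = (\<lambda>x. g x + 1 * wave N x)"
  define gm where "gm = (\<lambda>x. g x + (-1) * wave N x)"
  let ?S = "dyadic_slope N g" and ?T = "dyadic_slope (Suc N)"
  have \<sigma>: "0 \<le> \<sigma>" "\<sigma> \<le> 1"
    using amp_pos[of N] amp_antimono[of 0 N] amp_def[of 0] by (auto simp: \<sigma>_def)
  have pair: "polygon_length (Suc N) h
      = (\<Sum>k<2 ^ N. bracket (?T h (2 * k)) + bracket (?T h (2 * k + 1))) / 2 ^ Suc N" for h
  proof -
    have "(\<Sum>k<2 ^ N. bracket (?T h (2 * k)) + bracket (?T h (2 * k + 1)))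
        = (\<Sum>m<2 ^ N. sum (\<lambda>k. bracket (?T h k)) {m * 2..<m * 2 + 2})"
      by (intro sum.cong refl) (simp add: numeral_2_eq_2 mult.commute)
    also have "\<dots> = (\<Sum>k<2 ^ Suc N. bracket (?T h k))"
      by (subst sum.nat_group) (simp add: mult.commute)
    finally show ?thesis by (simp add: polygon_length_def)
  qed
  have step: "4 * bracket (?S k) + \<sigma>\<^sup>2 / 2 * (1 / bracket (?S k) ^ 3)
      \<le> (bracket (?T gp (2 * k)) + bracket (?T gp (2 * k + 1)))
        + (bracket (?T gm (2 * k)) + bracket (?T gm (2 * k + 1)))" for k
  proof -
    define s where "s = ?S k"
    define D where "D = (?T g (2 * k) - ?T g (2 * k + 1)) / 2"
    have "?T g (2 * k) = s + D" "?T g (2 * k + 1) = s - D"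
      unfolding s_def D_def dyadic_slope_eq_mean[of N] by (simp_all add: field_simps)
    then have "?T gp (2 * k) = (s - \<sigma>) + D" "?T gp (2 * k + 1) = (s + \<sigma>) - D"
      "?T gm (2 * k) = (s + \<sigma>) + D" "?T gm (2 * k + 1) = (s - \<sigma>) - D"
      unfolding gp_def gm_def dyadic_slope_add_wave \<sigma>_def by simp_all
    moreover have "\<sigma>\<^sup>2 / 2 * (1 / bracket s ^ 3) = 2 * (\<sigma>\<^sup>2 / (4 * bracket s ^ 3))" by simp
    ultimately show ?thesis
      using bracket_midpoint_convex[of "s + \<sigma>" D] bracket_midpoint_convex[of "s - \<sigma>" D]
        bracket_midpoint_strict_convex[OF \<sigma>, of s]
      unfolding s_def[symmetric] by (simp only:)
  qed
  have "2 * polygon_length N g + \<sigma>\<^sup>2 / 4 * ((\<Sum>k<2 ^ N. 1 / bracket (?S k) ^ 3) / 2 ^ N)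
      = (\<Sum>k<2 ^ N. 4 * bracket (?S k) + \<sigma>\<^sup>2 / 2 * (1 / bracket (?S k) ^ 3)) / 2 ^ Suc N"
    unfolding sum.distrib sum_distrib_left[symmetric] polygon_length_def
    by (simp add: field_simps)
  also have "\<dots> \<le> polygon_length (Suc N) gp + polygon_length (Suc N) gm"
    unfolding pair add_divide_distrib[symmetric] sum.distrib[symmetric]
    by (intro divide_right_mono sum_mono step) auto
  finally show ?thesis unfolding \<sigma>_def gp_def gm_def .
qed

text \<open>A Jensen inequality: average the tangent at \<open>V\<close>, whose negative slope lets
  the mean be replaced by its upper bound \<open>V\<close>. Bounded length thus keeps the convexity
  gain away from zero.\<close>

lemma mean_inverse_cube_ge:
  assumes "polygon_length N g \<le> V" "V \<ge> 1"
  shows "1 / V ^ 3 \<le> (\<Sum>k<2 ^ N. 1 / bracket (dyadic_slope N g k) ^ 3) / 2 ^ N"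
proof -
  let ?b = "\<lambda>k. bracket (dyadic_slope N g k)"
  have "1 / V ^ 3 = 4 / V ^ 3 - 3 / V ^ 4 * V"
    using assms by (simp add: field_simps power_eq_if)
  also have "\<dots> \<le> 4 / V ^ 3 - 3 / V ^ 4 * polygon_length N g"
    using assms by (intro diff_left_mono mult_left_mono) auto
  also have "\<dots> = (\<Sum>k<2 ^ N. 4 / V ^ 3 - 3 * ?b k / V ^ 4) / 2 ^ N"
    unfolding polygon_length_def sum_subtractf
    by (simp add: sum_distrib_left sum_divide_distrib diff_divide_distrib)
  also have "\<dots> \<le> (\<Sum>k<2 ^ N. 1 / ?b k ^ 3) / 2 ^ N"
    by (intro divide_right_mono sum_mono inverse_cube_ge_tangent bracket_ge_1 assms) auto
  finally show ?thesis .
qed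

text \<open>The two signs together gain at least \<open>1 / (4 * (real N + 1) * V ^ 3)\<close>, so
  the longer polygon gains half of that. The sign is chosen before \<open>V\<close>, so one sequence
  of signs serves every bound.\<close>

lemma ex_sign_polygon_length_growth:
  "\<exists>c\<in>{-1, 1}. \<forall>V\<ge>1. polygon_length N g \<le> V \<longrightarrow>
     polygon_length N g + 1 / (8 * V ^ 3 * (real N + 1))
       \<le> polygon_length (Suc N) (\<lambda>x. g x + c * wave N x)"
proof -
  let ?L = "\<lambda>c. polygon_length (Suc N) (\<lambda>x. g x + c * wave N x)"
  define c :: real where "c = (if ?L (-1) \<le> ?L 1 then 1 else -1)"
  have c: "?L 1 + ?L (-1) \<le> 2 * ?L c" by (auto simp: c_def)
  have "polygon_length N g + 1 / (8 * V ^ 3 * (real N + 1)) \<le> ?L c"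
    if V: "V \<ge> 1" "polygon_length N g \<le> V" for V
  proof -
    have a: "(4 * amp N)\<^sup>2 / 4 = 1 / (4 * (real N + 1))"
      by (simp add: amp_def power_divide)
    have "1 / (4 * (real N + 1)) * (1 / V ^ 3)
        \<le> 1 / (4 * (real N + 1)) * ((\<Sum>k<2 ^ N. 1 / bracket (dyadic_slope N g k) ^ 3) / 2 ^ N)"
      by (intro mult_left_mono mean_inverse_cube_ge V) auto
    then have "2 * polygon_length N g + 1 / (4 * (real N + 1)) * (1 / V ^ 3) \<le> 2 * ?L c"
      using sum_polygon_length_refine[of N g] c unfolding a by linarith
    moreover have "1 / (4 * a) * (1 / b) = 2 * (1 / (8 * b * a))" for a b :: real by simp
    ultimately show ?thesis by (simp only:)
  qed
  then show ?thesis by (intro bexI[of _ c]) (auto simp: c_def)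
qed

lemma ex_signs_polygon_length_growth:
  obtains e :: "nat \<Rightarrow> real" where "\<And>n. \<bar>e n\<bar> \<le> 1"
    "\<And>V N. V \<ge> 1 \<Longrightarrow> polygon_length N (partial_wave e N) \<le> V \<Longrightarrow>
      polygon_length N (partial_wave e N) + 1 / (8 * V ^ 3 * (real N + 1))
        \<le> polygon_length (Suc N) (partial_wave e (Suc N))"
proof -
  obtain sg where sg: "\<And>N g. sg N g \<in> {-1, 1 :: real}"
    "\<And>N g V. V \<ge> 1 \<Longrightarrow> polygon_length N g \<le> V \<Longrightarrow>
      polygon_length N g + 1 / (8 * V ^ 3 * (real N + 1))
        \<le> polygon_length (Suc N) (\<lambda>x. g x + sg N g * wave N x)"
    using ex_sign_polygon_length_growth by metis
  \<comment> \<open>The sign at stage \<open>N\<close> depends on the partial sum built so far, so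
    sums and signs are produced by one recursion.\<close>
  define G where "G = rec_nat (\<lambda>x. 0 :: real) (\<lambda>N g x. g x + sg N g * wave N x)"
  define e where "e n = sg n (G n)" for n
  have G: "partial_wave e N = G N" for N
    by (induction N) (auto simp: partial_wave_def G_def e_def fun_eq_iff)
  have GS: "G (Suc N) = (\<lambda>x. G N x + sg N (G N) * wave N x)" for N by (simp add: G_def)
  show thesis
  proof (rule that[of e])
    show "\<bar>e n\<bar> \<le> 1" for n using sg(1)[of n "G n"] by (auto simp: e_def)
  qed (unfold G GS, rule sg(2))
qed

text \<open>If the lengths stayed bounded, the increments would dominate a fixed multiple of the
  harmonic series.\<close>

lemma polygon_length_unbounded:
  assumes growth: "\<And>V N. V \<ge> 1 \<Longrightarrow> polygon_length N (partial_wave e N) \<le> V \<Longrightarrow>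
      polygon_length N (partial_wave e N) + 1 / (8 * V ^ 3 * (real N + 1))
        \<le> polygon_length (Suc N) (partial_wave e (Suc N))"
  obtains N where "polygon_length N (partial_wave e N) > V"
proof -
  let ?L = "\<lambda>N. polygon_length N (partial_wave e N)"
  have False if bd: "\<And>N. ?L N \<le> V"
  proof -
    define W where "W = max V 1"
    have W: "W \<ge> 1" "\<And>N. ?L N \<le> W" using bd by (auto simp: W_def intro: max.coboundedI1)
    have "(\<Sum>n<N. 1 / (8 * W ^ 3 * (real n + 1))) \<le> ?L N" for N
    proof (induction N)
      case 0
      have "?L 0 \<ge> 0" unfolding polygon_length_def bracket_def
        by (intro divide_nonneg_nonneg sum_nonneg) auto
      then show ?case by simp
    next
      case (Suc N)
      then show ?case using growth[OF W(1) W(2)[of N]] by simp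
    qed
    then have "summable (\<lambda>n. 1 / (8 * W ^ 3 * (real n + 1)))"
      using W by (intro summableI_nonneg_bounded[where x = W]) (auto intro: order_trans)
    then have "summable (\<lambda>n. (8 * W ^ 3) * (1 / (8 * W ^ 3 * (real n + 1))))"
      by (rule summable_mult)
    then have "summable (\<lambda>n. inverse (real (Suc n)))"
      using W by (simp add: inverse_eq_divide add.commute)
    then show False
      using not_summable_harmonic[where 'a = real] summable_Suc_iff by blast
  qed
  then show thesis using that by (meson not_le)
qed

section \<open>Variation controlled by the Hausdorff measure of the graph\<close>

definition graph_point :: "(real \<Rightarrow> real) \<Rightarrow> real \<Rightarrow> real ^ 2" where
  "graph_point f x = vector [x, f x]"

lemma graph_point_nth [simp]: "graph_point f x $ 1 = x" "graph_point f x $ 2 = f x"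
  by (simp_all add: graph_point_def)

text \<open>By the intermediate value theorem the image contains the interval between
  \<open>f a\<close> and \<open>f b\<close>, whose Lebesgue measure is the left side.\<close>

lemma ennreal_diff_le_suminf_of_image_cover:
  fixes f :: "real \<Rightarrow> real"
  assumes cont: "continuous_on {a..b} f" and "a \<le> b"
    and cover: "f ` {a..b} \<subseteq> (\<Union>i::nat. J i)" and J: "\<And>i. J i \<in> sets lborel"
  shows "ennreal \<bar>f b - f a\<bar> \<le> (\<Sum>i. emeasure lborel (J i))"
proof -
  let ?I = "{min (f a) (f b)..max (f a) (f b)}"
  have "is_interval (f ` {a..b})"
    using cont by (simp add: is_interval_connected_1 connected_continuous_image)
  moreover have "f a \<in> f ` {a..b}" "f b \<in> f ` {a..b}" using \<open>a \<le> b\<close> by auto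
  ultimately have "?I \<subseteq> f ` {a..b}"
    by (auto simp: min_def max_def simp del: image_iff split: if_splits
        intro: mem_is_interval_1_I[of "f ` {a..b}"])
  then have "emeasure lborel ?I \<le> emeasure lborel (\<Union>i. J i)"
    using cover J by (intro emeasure_mono) auto
  also have "\<dots> \<le> (\<Sum>i. emeasure lborel (J i))"
    using J by (intro emeasure_subadditive_countably) auto
  finally show ?thesis by (simp add: max_def min_def split: if_splits)
qed

lemma card_le_2I:
  fixes T :: "nat set"
  assumes "\<And>k k'. k \<in> T \<Longrightarrow> k' \<in> T \<Longrightarrow> k' < k + 2"
  shows "card T \<le> 2"
proof (cases "T = {}")
  case False
  define m where "m = (LEAST k. k \<in> T)"
  have "m \<in> T" "\<And>k. k \<in> T \<Longrightarrow> m \<le> k"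
    using False unfolding m_def by (auto intro: LeastI Least_le)
  then have "T \<subseteq> {m, Suc m}" using assms[of m] by fastforce
  then have "card T \<le> card {m, Suc m}" by (intro card_mono) auto
  then show ?thesis by simp
qed simp

text \<open>
  A set of diameter less than the mesh \<open>1 / M\<close> meets the graph over at most two grid intervals,
  so the covers need not be split; this costs one factor \<open>2\<close>. The other comes from
  enclosing the second coordinates of \<open>C i\<close> in an interval of length twice the diameter.
\<close>

lemma variation_le_hausdorff_measure:
  fixes f :: "real \<Rightarrow> real" and K :: "nat set"
  assumes cont: "continuous_on UNIV f" and "finite K" and "M > 0"
    and sub: "\<And>k x. k \<in> K \<Longrightarrow> real k / M \<le> x \<Longrightarrow> x \<le> real (Suc k) / M \<Longrightarrow> graph_point f x \<in> B"
  shows "ennreal (\<Sum>k\<in>K. \<bar>f (real (Suc k) / M) - f (real k / M)\<bar>) \<le> 4 * hausdorff_measure 1 B"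
proof -
  define d where "d = 1 / (2 * M)"
  have d: "0 < d" "d < 1 / M" using \<open>M > 0\<close> by (auto simp: d_def field_simps)
  let ?\<Delta> = "\<lambda>k. \<bar>f (real (Suc k) / M) - f (real k / M)\<bar>"
  have "ennreal (\<Sum>k\<in>K. ?\<Delta> k) \<le> 4 * (\<Sum>i. hausdorff_weight 1 (C i))"
    if C: "B \<subseteq> (\<Union>i. C i)" and bd: "\<And>i. bounded (C i)" and dm: "\<And>i. diameter (C i) \<le> d"
    for C :: "nat \<Rightarrow> (real ^ 2) set"
  proof -
    define D where "D i = diameter (C i)" for i
    \<comment> \<open>For empty \<open>C i\<close> this value is arbitrary, which is harmless
      because then \<open>T i\<close> is empty.\<close>
    define v where "v i = (SOME p. p \<in> C i) $ 2" for i
    define J where "J i = {v i - D i..v i + D i}" for i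
    define T where "T i = {k \<in> K. \<exists>x. real k / M \<le> x \<and> x \<le> real (Suc k) / M \<and> graph_point f x \<in> C i}"
      for i
    have D0: "D i \<ge> 0" for i using diameter_ge_0[OF bd] by (simp add: D_def)
    have dist: "\<bar>p $ j - q $ j\<bar> \<le> D i" if "p \<in> C i" "q \<in> C i" for p q i j
      using diameter_bounded_bound[OF bd that] dist_vec_nth_le[of p j q]
      by (simp add: D_def dist_real_def)
    have inJ: "p $ 2 \<in> J i" if "p \<in> C i" for p i
      using dist[OF that someI[of "\<lambda>p. p \<in> C i", OF that], of 2]
      by (auto simp: J_def v_def abs_le_iff)
    have "card (T i) \<le> 2" for i
    proof (rule card_le_2I, rule ccontr)
      fix k k' assume "k \<in> T i" "k' \<in> T i" "\<not> k' < k + 2"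
      then obtain x x' where x: "x \<le> real (Suc k) / M" "graph_point f x \<in> C i"
        and x': "real k' / M \<le> x'" "graph_point f x' \<in> C i"
        by (auto simp: T_def)
      \<comment> \<open>Indices at least two apart leave a full grid interval between the two
        abscissas.\<close>
      have "real (Suc k) / M + 1 / M \<le> real k' / M"
        using \<open>\<not> k' < k + 2\<close> \<open>M > 0\<close> unfolding add_divide_distrib[symmetric]
        by (intro divide_right_mono) auto
      then have "1 / M \<le> \<bar>x' - x\<bar>" using x x' by linarith
      also have "\<dots> \<le> D i" using dist[OF x'(2) x(2), of 1] by simp
      also have "\<dots> \<le> d" using dm by (simp add: D_def)
      finally show False using d by simp
    qed
    note card_T = this
    have weight: "(\<Sum>k\<in>K. emeasure lborel (if k \<in> T i then J i else {})) \<le> 4 * hausdorff_weight 1 (C i)"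
      for i
    proof (cases "C i = {}")
      case True
      then show ?thesis by (simp add: T_def)
    next
      case False
      have "(\<Sum>k\<in>K. emeasure lborel (if k \<in> T i then J i else {})) = (\<Sum>k\<in>T i. ennreal (2 * D i))"
        using D0[of i] \<open>finite K\<close>
        by (intro sum.mono_neutral_cong_right) (auto simp: T_def J_def)
      also have "\<dots> = ennreal (real (card (T i)) * (2 * D i))"
        using D0[of i] by (simp add: ennreal_mult ennreal_of_nat_eq_real_of_nat)
      also have "\<dots> \<le> ennreal (2 * (2 * D i))"
        using D0[of i] card_T[of i] by (intro ennreal_leI mult_right_mono) auto
      \<comment> \<open>In dimension 1 the weight of a nonempty set is its diameter, since the unit
        ball has volume 2.\<close>
      also have "\<dots> = 4 * hausdorff_weight 1 (C i)"
        using False D0[of i] by (simp add: hausdorff_weight_def D_def ennreal_mult)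
      finally show ?thesis .
    qed
    have "ennreal (?\<Delta> k) \<le> (\<Sum>i. emeasure lborel (if k \<in> T i then J i else {}))" if kK: "k \<in> K" for k
    proof (rule ennreal_diff_le_suminf_of_image_cover[of "real k / M" "real (Suc k) / M" f])
      show "continuous_on {real k / M..real (Suc k) / M} f"
        using cont by (rule continuous_on_subset) simp
      show "real k / M \<le> real (Suc k) / M" using \<open>M > 0\<close> by (simp add: divide_right_mono)
      show "f ` {real k / M..real (Suc k) / M} \<subseteq> (\<Union>i. if k \<in> T i then J i else {})"
      proof (rule image_subsetI)
        fix x assume x: "x \<in> {real k / M..real (Suc k) / M}"
        then obtain i where i: "graph_point f x \<in> C i"
          using sub[OF kK, of x] C by auto
        then have "k \<in> T i" "f x \<in> J i"
          using x kK inJ[OF i] by (auto simp: T_def)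
        then show "f x \<in> (\<Union>i. if k \<in> T i then J i else {})" by auto
      qed
    qed (auto simp: J_def)
    then have "(\<Sum>k\<in>K. ennreal (?\<Delta> k))
        \<le> (\<Sum>k\<in>K. \<Sum>i. emeasure lborel (if k \<in> T i then J i else {}))"
      by (rule sum_mono)
    also have "\<dots> = (\<Sum>i. \<Sum>k\<in>K. emeasure lborel (if k \<in> T i then J i else {}))"
      by (rule suminf_sum[symmetric]) simp
    also have "\<dots> \<le> (\<Sum>i. 4 * hausdorff_weight 1 (C i))"
      by (intro suminf_le weight) auto
    finally show ?thesis by (simp add: sum_ennreal)
  qed
  then have "ennreal (\<Sum>k\<in>K. ?\<Delta> k) / 4 \<le> hausdorff_premeasure d 1 B"
    unfolding hausdorff_premeasure_def
    by (intro INF_greatest divide_le_posI_ennreal) auto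
  also have "\<dots> \<le> hausdorff_measure 1 B"
    unfolding hausdorff_measure_def using d by (intro SUP_upper) auto
  finally have "4 * (ennreal (\<Sum>k\<in>K. ?\<Delta> k) / 4) \<le> 4 * hausdorff_measure 1 B"
    by (rule mult_left_mono) simp
  moreover have "4 * (x / 4) = x" for x :: ennreal
    using mult_divide_eq_ennreal[of 4 x] by (simp add: ennreal_times_divide mult.commute)
  ultimately show ?thesis by simp
qed


text \<open>Local finiteness bounds the dyadic variation near each abscissa, uniformly in
  \<open>N\<close>; compactness of the unit interval, in the bisection form of
  \<open>Bolzano\<close>, makes the bound global.\<close>

lemma locally_finite_graph_imp_bounded_variation:
  fixes f :: "real \<Rightarrow> real"
  assumes cont: "continuous_on UNIV f" and bdd: "\<And>x. \<bar>f x\<bar> \<le> c"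
    and fin: "weak_locally_finite_hausdorff 1 (range (graph_point f))"
  shows "\<exists>V. \<forall>N. (\<Sum>k<2 ^ N. \<bar>f (real (Suc k) / 2 ^ N) - f (real k / 2 ^ N)\<bar>) \<le> V"
proof -
  let ?\<Delta> = "\<lambda>N k. \<bar>f (real (Suc k) / 2 ^ N) - f (real k / 2 ^ N)\<bar>"
  define K where "K N a b = {k :: nat. a \<le> real k / 2 ^ N \<and> real (Suc k) / 2 ^ N \<le> b}"
    for N :: nat and a b :: real
  have fK: "finite (K N a b)" for N a b
  proof (rule finite_subset)
    show "K N a b \<subseteq> {..nat \<lfloor>b * 2 ^ N\<rfloor>}"
      by (auto simp: K_def divide_le_eq le_nat_iff le_floor_iff)
  qed simp
  have sum_Un_le: "(\<Sum>k\<in>A \<union> B. ?\<Delta> N k) \<le> (\<Sum>k\<in>A. ?\<Delta> N k) + (\<Sum>k\<in>B. ?\<Delta> N k)"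
    if "finite A" "finite B" for A B N
    using sum_Un[OF that, of "?\<Delta> N"] sum_nonneg[of "A \<inter> B" "?\<Delta> N"] by simp
  define P where "P a b \<longleftrightarrow> (\<exists>V. \<forall>N. (\<Sum>k\<in>K N a b. ?\<Delta> N k) \<le> V)" for a b
  have "P 0 1"
  proof (rule Bolzano[of 0 1 P])
    fix a m b assume "P a m" "P m b"
    then obtain V W where V: "\<And>N. (\<Sum>k\<in>K N a m. ?\<Delta> N k) \<le> V"
      and W: "\<And>N. (\<Sum>k\<in>K N m b. ?\<Delta> N k) \<le> W" unfolding P_def by blast
    have "(\<Sum>k\<in>K N a b. ?\<Delta> N k) \<le> V + W + 2 * c" for N
    proof -
      \<comment> \<open>At most one grid interval has \<open>m\<close> in its interior. It lies in
        neither half and contributes at most \<open>2 * c\<close>.\<close>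
      define j where "j = nat \<lfloor>m * 2 ^ N\<rfloor>"
      have "k = j" if "real k / 2 ^ N < m" "m < real (Suc k) / 2 ^ N" for k
      proof -
        have "\<lfloor>m * 2 ^ N\<rfloor> = int k"
          using that by (intro floor_unique) (auto simp: field_simps)
        then show ?thesis by (simp add: j_def)
      qed
      then have "K N a b \<subseteq> (K N a m \<union> K N m b) \<union> {j}"
        unfolding K_def by force
      then have "(\<Sum>k\<in>K N a b. ?\<Delta> N k) \<le> (\<Sum>k\<in>(K N a m \<union> K N m b) \<union> {j}. ?\<Delta> N k)"
        using fK by (intro sum_mono2) auto
      also have "\<dots> \<le> (\<Sum>k\<in>K N a m \<union> K N m b. ?\<Delta> N k) + (\<Sum>k\<in>{j}. ?\<Delta> N k)"
        by (intro sum_Un_le finite_UnI fK finite.intros)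
      also have "(\<Sum>k\<in>K N a m \<union> K N m b. ?\<Delta> N k)
          \<le> (\<Sum>k\<in>K N a m. ?\<Delta> N k) + (\<Sum>k\<in>K N m b. ?\<Delta> N k)"
        by (intro sum_Un_le fK)
      also have "(\<Sum>k\<in>{j}. ?\<Delta> N k) \<le> 2 * c"
        using bdd[of "real (Suc j) / 2 ^ N"] bdd[of "real j / 2 ^ N"] by simp
      finally show ?thesis using V[of N] W[of N] by linarith
    qed
    then show "P a b" unfolding P_def by blast
  next
    fix x
    obtain r where r: "r > 0"
      "hausdorff_measure 1 (ball (graph_point f x) r \<inter> range (graph_point f)) < \<infinity>"
      using fin unfolding weak_locally_finite_hausdorff_def by blast
    let ?B = "ball (graph_point f x) r \<inter> range (graph_point f)"
    have "continuous_on UNIV (\<lambda>x. \<chi> i. graph_point f x $ i)"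
    proof (rule continuous_on_vec_lambda)
      show "continuous_on UNIV (\<lambda>x. graph_point f x $ i)" for i
        using cont exhaust_2[of i] by auto
    qed
    then have "continuous_on UNIV (graph_point f)" by simp
    then obtain d where d: "d > 0" "\<And>z. \<bar>z - x\<bar> < d \<Longrightarrow> graph_point f z \<in> ball (graph_point f x) r"
      using \<open>r > 0\<close> unfolding continuous_on_iff mem_ball
      by (metis UNIV_I dist_commute dist_real_def)
    show "\<exists>d>0. \<forall>a b. a \<le> x \<and> x \<le> b \<and> b - a < d \<longrightarrow> P a b"
    proof (intro exI[of _ d] conjI allI impI \<open>d > 0\<close>)
      fix a b assume ab: "a \<le> x \<and> x \<le> b \<and> b - a < d"
      have "(\<Sum>k\<in>K N a b. ?\<Delta> N k) \<le> enn2real (4 * hausdorff_measure 1 ?B)" for N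
      proof -
        have "ennreal (\<Sum>k\<in>K N a b. ?\<Delta> N k) \<le> 4 * hausdorff_measure 1 ?B"
        proof (rule variation_le_hausdorff_measure[OF cont fK])
          fix k z assume "k \<in> K N a b" "real k / 2 ^ N \<le> z" "z \<le> real (Suc k) / 2 ^ N"
          then have "a \<le> z" "z \<le> b" by (auto simp: K_def)
          with ab have "\<bar>z - x\<bar> < d" by linarith
          then show "graph_point f z \<in> ?B" using d(2) by blast
        qed simp
        \<comment> \<open>Finiteness is essential before passing to reals, as
          \<open>enn2real\<close> sends \<open>top\<close> to 0.\<close>
        moreover have "4 * hausdorff_measure 1 ?B < top"
          using r(2) by (simp add: ennreal_mult_less_top)
        ultimately have "enn2real (ennreal (\<Sum>k\<in>K N a b. ?\<Delta> N k))
            \<le> enn2real (4 * hausdorff_measure 1 ?B)"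
          by (rule enn2real_mono)
        then show ?thesis by (simp add: sum_nonneg)
      qed
      then show "P a b" unfolding P_def by blast
    qed
  qed simp
  moreover have "K N 0 1 = {..<2 ^ N}" for N
  proof -
    have "real (Suc k) / 2 ^ N \<le> 1 \<longleftrightarrow> real (Suc k) \<le> real (2 ^ N)" for k
      by (simp add: divide_le_eq)
    then show ?thesis
      by (simp only: K_def of_nat_le_iff Suc_le_eq lessThan_def) simp
  qed
  ultimately show ?thesis unfolding P_def by simp
qed

section \<open>From flatness of the function to property (iv) of its graph\<close>

lemma graph_fine_weak_approx:
  fixes f :: "real \<Rightarrow> real"
  assumes flat: "\<And>\<delta>. \<delta> > 0 \<Longrightarrow> \<exists>r>0. \<forall>\<rho> c. 0 < \<rho> \<longrightarrow> \<rho> \<le> r \<longrightarrow>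
      (\<exists>m. \<forall>x. \<bar>x - c\<bar> \<le> \<rho> \<longrightarrow> \<bar>f x - f c - m * (x - c)\<bar> < \<delta> * \<rho>)"
  shows "fine_weak_approx_local_uniform 1 (range (graph_point f))"
  unfolding fine_weak_approx_local_uniform_def
proof (intro allI ballI impI)
  fix \<delta> :: real and y :: "real ^ 2"
  assume "\<delta> > 0"
  then obtain r where r: "r > 0" "\<And>\<rho> c. 0 < \<rho> \<Longrightarrow> \<rho> \<le> r \<Longrightarrow>
      \<exists>m. \<forall>x. \<bar>x - c\<bar> \<le> \<rho> \<longrightarrow> \<bar>f x - f c - m * (x - c)\<bar> < \<delta> * \<rho>"
    using flat by meson
  show "\<exists>\<rho>\<^sub>y>0. \<forall>\<rho>\<in>{0<..\<rho>\<^sub>y}. \<forall>x\<in>ball y \<rho>\<^sub>y. \<exists>L. affine L \<and> aff_dim L = int 1 \<and>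
      ball x \<rho> \<inter> range (graph_point f) \<subseteq> thickening L (\<delta> * \<rho>)"
  proof (intro exI[of _ r] conjI ballI r(1))
    fix \<rho> and x :: "real ^ 2" assume "\<rho> \<in> {0<..r}"
    \<comment> \<open>The centre \<open>x\<close> need not lie on the graph: the line passes through
      the graph point above or below it, and the ball projects into the interval of radius
      \<open>\<rho>\<close> about \<open>c\<close>.\<close>
    define c where "c = x $ 1"
    obtain m where m: "\<And>u. \<bar>u - c\<bar> \<le> \<rho> \<Longrightarrow> \<bar>f u - f c - m * (u - c)\<bar> < \<delta> * \<rho>"
      using r(2)[of \<rho> c] \<open>\<rho> \<in> {0<..r}\<close> by auto
    define \<phi> :: "real \<Rightarrow> real ^ 2" where "\<phi> u = vector [u, f c + m * (u - c)]" for u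
    define L where "L = affine hull {\<phi> 0, \<phi> 1}"
    have \<phi>L: "\<phi> u \<in> L" for u
    proof -
      have "\<phi> u = (1 - u) *\<^sub>R \<phi> 0 + u *\<^sub>R \<phi> 1"
        by (simp add: vec_eq_iff forall_2 \<phi>_def algebra_simps)
      then show ?thesis unfolding L_def affine_hull_2 by force
    qed
    have "\<phi> 0 \<noteq> \<phi> 1" by (simp add: vec_eq_iff forall_2 \<phi>_def)
    then have "affine L" "aff_dim L = int 1" by (simp_all add: L_def)
    moreover have "ball x \<rho> \<inter> range (graph_point f) \<subseteq> thickening L (\<delta> * \<rho>)"
    proof safe
      fix u assume "graph_point f u \<in> ball x \<rho>"
      then have "\<bar>u - c\<bar> \<le> \<rho>"
        using dist_vec_nth_le[of x 1 "graph_point f u"] by (simp add: c_def dist_real_def)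
      then have "\<bar>f u - f c - m * (u - c)\<bar> < \<delta> * \<rho>" by (rule m)
      moreover have "norm (graph_point f u - \<phi> u) = \<bar>f u - f c - m * (u - c)\<bar>"
        by (simp add: norm_vec_def L2_set_def sum_2 \<phi>_def algebra_simps)
      ultimately show "graph_point f u \<in> thickening L (\<delta> * \<rho>)"
        unfolding thickening_def using \<phi>L[of u] by (auto intro!: bexI[of _ "\<phi> u"])
    qed
    ultimately show "\<exists>L. affine L \<and> aff_dim L = int 1 \<and>
        ball x \<rho> \<inter> range (graph_point f) \<subseteq> thickening L (\<delta> * \<rho>)" by blast
  qed
qed

theorem theorem5p1:
  shows "\<exists>A :: (real ^ 2) set.
    fine_weak_approx_local_uniform 1 A \<and> \<not> weak_locally_finite_hausdorff 1 A"
proof -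
  obtain e :: "nat \<Rightarrow> real" where e: "\<And>n. \<bar>e n\<bar> \<le> 1"
    and growth: "\<And>V N. V \<ge> 1 \<Longrightarrow> polygon_length N (partial_wave e N) \<le> V \<Longrightarrow>
      polygon_length N (partial_wave e N) + 1 / (8 * V ^ 3 * (real N + 1))
        \<le> polygon_length (Suc N) (partial_wave e (Suc N))"
    by (rule ex_signs_polygon_length_growth) blast
  let ?f = "lacunary e"
  have "fine_weak_approx_local_uniform 1 (range (graph_point ?f))"
    by (intro graph_fine_weak_approx lacunary_flat e)
  moreover have "\<not> weak_locally_finite_hausdorff 1 (range (graph_point ?f))"
  proof
    assume "weak_locally_finite_hausdorff 1 (range (graph_point ?f))"
    from locally_finite_graph_imp_bounded_variation
      [OF continuous_lacunary[of e, OF e] lacunary_bounded[of e, OF e] this]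
    obtain V where V:
      "\<And>N. (\<Sum>k<2 ^ N. \<bar>?f (real (Suc k) / 2 ^ N) - ?f (real k / 2 ^ N)\<bar>) \<le> V"
      by blast
    obtain N where N: "polygon_length N (partial_wave e N) > 1 + V"
      by (rule polygon_length_unbounded[of e, OF growth])
    \<comment> \<open>Since \<open>bracket s\<close> is at most 1 plus the absolute slope, the
      length exceeds the variation by at most 1, against the choice of \<open>N\<close>.\<close>
    have "polygon_length N (partial_wave e N)
        \<le> (\<Sum>k<2 ^ N. 1 + \<bar>dyadic_slope N ?f k\<bar>) / 2 ^ N"
      unfolding polygon_length_def dyadic_slope_lacunary[of e, OF e]
      by (intro divide_right_mono sum_mono bracket_le) auto
    also have "\<dots> = 1 + (\<Sum>k<2 ^ N. \<bar>?f (real (Suc k) / 2 ^ N) - ?f (real k / 2 ^ N)\<bar>)"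
      unfolding dyadic_slope_def abs_mult sum.distrib sum_distrib_left[symmetric]
      by (simp add: add_divide_distrib)
    also have "\<dots> \<le> 1 + V" using V by simp
    finally show False using N by simp
  qed
  ultimately show ?thesis by blast
qed

end
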